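(* Let $G$ be a group of homeomorphisms of a Hausdorff space $X$, let $n\ge1$, and let $H_1,\ldots,H_n\le\mathrm{Homeo}(X)$ be subgroups such that $(H_1,\ldots,H_n)$ is confined by $G$. Then there exist $k\le n$ and a non-empty open subset $U\subset X$ such that $H_k$ contains $\mathrm{Rist}_G(U)'$. (In particular, for $n=1$: if $H$ is a confined subgroup of $G$, then $H\supseteq\mathrm{Rist}_G(U)'$ for some non-empty open $U\subset X$.)
   Context: The $n$-tuple $(H_1,\ldots,H_n)$ of subgroups of $\mathrm{Homeo}(X)$ is confined by $G\le\mathrm{Homeo}(X)$ if there exists a finite set $P$ of non-trivial elements of $\mathrm{Homeo}(X)$ such that for every $g\in G$ there exists $j$ with $gH_jg^{-1}\cap P\neq\varnothing$. For $U\subset X$, the rigid stabilizer $\mathrm{Rist}_G(U)$ is the subgroup of elements of $G$ fixing $X\setminus U$ pointwise, and $K'$ denotes the derived (commutator) subgroup of a group $K$. *)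

theory Defs
  imports "HOL-Analysis.Analysis"
begin

definition homeo :: "('a::topological_space \<Rightarrow> 'a) \<Rightarrow> bool" where
  "homeo f \<longleftrightarrow> bij f \<and> continuous_on UNIV f \<and> continuous_on UNIV (inv f)"

definition Homeo :: "('a::topological_space \<Rightarrow> 'a) set" where
  "Homeo = {f. homeo f}"

definition homeo_subgroup :: "('a::topological_space \<Rightarrow> 'a) set \<Rightarrow> bool" where
  "homeo_subgroup H \<longleftrightarrow> H \<subseteq> Homeo \<and> id \<in> H \<and>
     (\<forall>f\<in>H. \<forall>g\<in>H. f \<circ> g \<in> H) \<and> (\<forall>f\<in>H. inv f \<in> H)"

definition derived :: "('a::topological_space \<Rightarrow> 'a) set \<Rightarrow> ('a \<Rightarrow> 'a) set" where
  "derived K = \<Inter> {L. homeo_subgroup L \<and>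
     {a \<circ> b \<circ> inv a \<circ> inv b | a b. a \<in> K \<and> b \<in> K} \<subseteq> L}"

definition Rist :: "('a \<Rightarrow> 'a) set \<Rightarrow> 'a set \<Rightarrow> ('a \<Rightarrow> 'a) set" where
  "Rist G U = {g \<in> G. \<forall>x. x \<notin> U \<longrightarrow> g x = x}"

definition confined :: "('a::topological_space \<Rightarrow> 'a) set \<Rightarrow> nat \<Rightarrow> (nat \<Rightarrow> ('a \<Rightarrow> 'a) set) \<Rightarrow> bool" where
  "confined G n H \<longleftrightarrow> (\<exists>P. finite P \<and> P \<subseteq> Homeo - {id} \<and>
     (\<forall>g\<in>G. \<exists>j\<in>{1..n}. (\<lambda>h. g \<circ> h \<circ> inv g) ` H j \<inter> P \<noteq> {}))"

end

theory Submission
  imports Defs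
begin

text \<open>
  Suppose the theorem fails. Then every rigid stabilizer of a non-empty open set is non-abelian, so
  non-empty open sets are infinite. Let \<open>I\<close> be the set of pairs \<open>i = (p\<^sub>i, k\<^sub>i)\<close> with \<open>p\<^sub>i \<in> P\<close> and
  \<open>1 \<le> k\<^sub>i \<le> n\<close>, and choose disjoint non-empty open \<open>U\<^sub>i\<close> such that \<open>p\<^sub>i(U\<^sub>i)\<close> misses every \<open>U\<^sub>j\<close>. By
  confinement the product of the groups \<open>Rist(U\<^sub>i)\<close> is covered by the \<open>card I\<close> sets of those \<open>\<gamma>\<close> with
  \<open>\<gamma>\<inverse> p\<^sub>i \<gamma> \<in> H\<^sub>i\<close>, where \<open>H\<^sub>i\<close> is the subgroup with index \<open>k\<^sub>i\<close>. By a counting argument, for some \<open>i\<close> the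
  fibres of the \<open>i\<close>-th set over the other coordinates cannot all have density below \<open>1 / card I\<close> in
  a finite test set chosen in \<open>Rist(U\<^sub>i)\<close>. Two elements \<open>w, w'\<close> of a fibre give
  \<open>w\<inverse> w' \<cdot> p (w w'\<inverse>) p\<inverse> \<in> H\<^sub>i\<close>. Two kinds of test sets then show that, for one \<open>i\<close>, simultaneously

  \<^item> the group \<open>K\<close> of all \<open>a\<close> supported in \<open>U\<^sub>i\<close> such that \<open>a c \<in> H\<^sub>i\<close> for some \<open>c\<close> supported in
    \<open>p\<^sub>i(U\<^sub>i)\<close> meets \<open>Rist(U\<^sub>i)\<close> in a subgroup of finite index (test with representatives of distinct cosets),
  \<^item> \<open>H\<^sub>i \<inter> Rist(U\<^sub>i)\<close> is non-trivial (test with a grid of products \<open>s\<^sub>k v\<^sub>l\<close>: a dense subset of a grid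
    contains a rectangle, and a rectangle yields a conjugate of a commutator in \<open>H\<^sub>i\<close>).

  A non-trivial element of \<open>H\<^sub>i \<inter> Rist(U\<^sub>i)\<close> moves some open \<open>V\<close> off itself, and a double commutator puts
  the commutators of \<open>K \<inter> Rist(V)\<close> into \<open>H\<^sub>i\<close>. Among many disjoint open subsets of \<open>V\<close> three have rigid
  stabilizers meeting the same cosets of \<open>K\<close>; elements \<open>a, b\<close> of the first can then be corrected
  into \<open>K\<close> by elements of the second and of the third, which does not change \<open>[a, b]\<close>.
\<close>

subsection \<open>Supports and rigid stabilizers\<close>

definition supp_in :: "('a \<Rightarrow> 'a) \<Rightarrow> 'a set \<Rightarrow> bool" where
  "supp_in f A \<longleftrightarrow> bij f \<and> (\<forall>x. x \<notin> A \<longrightarrow> f x = x)"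

lemma supp_in_bij: "supp_in f A \<Longrightarrow> bij f"
  and supp_in_fix: "supp_in f A \<Longrightarrow> x \<notin> A \<Longrightarrow> f x = x"
  by (auto simp: supp_in_def)

lemma bij_cancel: "bij f \<Longrightarrow> inv f (f x) = x" "bij f \<Longrightarrow> f (inv f x) = x"
  by (auto simp: bij_is_inj bij_is_surj surj_f_inv_f)

lemma supp_in_mem: "supp_in f A \<Longrightarrow> f x \<in> A \<longleftrightarrow> x \<in> A"
  by (metis supp_in_def bij_cancel(1))

lemma supp_in_mono: "supp_in f A \<Longrightarrow> A \<subseteq> B \<Longrightarrow> supp_in f B"
  by (auto simp: supp_in_def)

lemma supp_in_comp: "supp_in f A \<Longrightarrow> supp_in g A \<Longrightarrow> supp_in (f \<circ> g) A"
  by (auto simp: supp_in_def bij_comp)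

lemma supp_in_inv:
  assumes "supp_in f A"
  shows "supp_in (inv f) A"
  unfolding supp_in_def
proof (intro conjI allI impI)
  show "bij (inv f)" using supp_in_bij[OF assms] by (rule bij_imp_bij_inv)
  fix x assume "x \<notin> A"
  then show "inv f x = x"
    using bij_cancel(1)[OF supp_in_bij[OF assms], of x] supp_in_fix[OF assms, of x] by simp
qed

lemma supp_in_conj:
  fixes p :: "'a \<Rightarrow> 'a"
  assumes f: "supp_in f A" and p: "bij p"
  shows "supp_in (p \<circ> f \<circ> inv p) (p ` A)"
proof -
  have "bij (p \<circ> f \<circ> inv p)"
    using supp_in_bij[OF f] p by (simp add: bij_comp bij_imp_bij_inv)
  moreover have "(p \<circ> f \<circ> inv p) x = x" if "x \<notin> p ` A" for x
  proof -
    have "inv p x \<notin> A" using that bij_cancel(2)[OF p, of x] by force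
    then show ?thesis using supp_in_fix[OF f] bij_cancel(2)[OF p] by simp
  qed
  ultimately show ?thesis by (simp add: supp_in_def)
qed

lemma supp_in_commute:
  assumes "supp_in f A" "supp_in g B" "A \<inter> B = {}"
  shows "f (g x) = g (f x)"
proof (cases "x \<in> A")
  case True
  then have "x \<notin> B" "f x \<notin> B" using assms supp_in_mem[OF assms(1)] by auto
  then show ?thesis using assms by (simp add: supp_in_fix)
next
  case False
  then have "g x \<notin> A" using assms supp_in_mem[OF assms(2), of x] supp_in_fix[OF assms(2), of x] by auto
  then show ?thesis using assms False by (simp add: supp_in_fix)
qed

lemma homeo_subgroup_bij: "homeo_subgroup H \<Longrightarrow> f \<in> H \<Longrightarrow> bij f"
  by (auto simp: homeo_subgroup_def Homeo_def homeo_def)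

lemma homeo_subgroup_id: "homeo_subgroup H \<Longrightarrow> id \<in> H"
  and homeo_subgroup_comp: "homeo_subgroup H \<Longrightarrow> f \<in> H \<Longrightarrow> g \<in> H \<Longrightarrow> f \<circ> g \<in> H"
  and homeo_subgroup_inv: "homeo_subgroup H \<Longrightarrow> f \<in> H \<Longrightarrow> inv f \<in> H"
  by (auto simp: homeo_subgroup_def)

lemma Rist_supp_in: "homeo_subgroup G \<Longrightarrow> g \<in> Rist G U \<Longrightarrow> supp_in g U"
  by (auto simp: Rist_def supp_in_def homeo_subgroup_bij)

lemma Rist_iff: "homeo_subgroup G \<Longrightarrow> g \<in> Rist G U \<longleftrightarrow> g \<in> G \<and> supp_in g U"
  by (auto simp: Rist_def supp_in_def homeo_subgroup_bij)

lemma Rist_mono: "U \<subseteq> V \<Longrightarrow> Rist G U \<subseteq> Rist G V"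
  by (auto simp: Rist_def)

lemma Rist_id: "homeo_subgroup G \<Longrightarrow> id \<in> Rist G U"
  by (auto simp: Rist_def homeo_subgroup_id)

lemma Rist_comp: "homeo_subgroup G \<Longrightarrow> f \<in> Rist G U \<Longrightarrow> g \<in> Rist G U \<Longrightarrow> f \<circ> g \<in> Rist G U"
  by (simp add: Rist_iff supp_in_comp homeo_subgroup_comp)

lemma Rist_inv: "homeo_subgroup G \<Longrightarrow> f \<in> Rist G U \<Longrightarrow> inv f \<in> Rist G U"
  by (simp add: Rist_iff supp_in_inv homeo_subgroup_inv)

lemma derived_subset:
  assumes "homeo_subgroup H" "\<And>a b. a \<in> K \<Longrightarrow> b \<in> K \<Longrightarrow> a \<circ> b \<circ> inv a \<circ> inv b \<in> H"
  shows "derived K \<subseteq> H"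
  unfolding derived_def using assms by (intro Inter_lower) auto

section \<open>Gluing elements supported in disjoint sets\<close>

text \<open>This is the element of the product of the groups supported in the \<open>U i\<close>
  with coordinates \<open>f i\<close>. The pointwise form fixes no order of composition, and for a
  disjoint family \<open>SOME\<close> has a single candidate.\<close>

definition glue :: "'i set \<Rightarrow> ('i \<Rightarrow> 'a set) \<Rightarrow> ('i \<Rightarrow> 'a \<Rightarrow> 'a) \<Rightarrow> 'a \<Rightarrow> 'a" where
  "glue I U f x = (if \<exists>i\<in>I. x \<in> U i then f (SOME i. i \<in> I \<and> x \<in> U i) x else x)"

lemma glue_in:
  assumes "disjoint_family_on U I" "i \<in> I" "x \<in> U i"
  shows "glue I U f x = f i x"
proof -
  have "(SOME i. i \<in> I \<and> x \<in> U i) = i"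
    using assms by (intro some_equality) (auto simp: disjoint_family_on_def)
  then show ?thesis using assms by (auto simp: glue_def)
qed

lemma glue_out: "(\<And>i. i \<in> I \<Longrightarrow> x \<notin> U i) \<Longrightarrow> glue I U f x = x"
  by (auto simp: glue_def)

text \<open>Membership in \<open>G\<close> comes from the finiteness of \<open>I\<close>: inserting
  an index composes with one more factor \<open>f i\<close>, which leaves the other pieces alone
  because the supports are disjoint.\<close>

lemma glue_Rist:
  assumes G: "homeo_subgroup G" and "finite I" "disjoint_family_on U I"
    and "\<And>i. i \<in> I \<Longrightarrow> f i \<in> Rist G (U i)"
  shows "glue I U f \<in> Rist G (\<Union>i\<in>I. U i)"
  using assms(2-)
proof (induction I)
  case empty
  have "glue {} U f = id" by (auto simp: glue_def)
  then show ?case using Rist_id[OF G] by metis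
next
  case (insert i I)
  have dI: "disjoint_family_on U I" using insert.prems by (auto simp: disjoint_family_on_def)
  have disj: "U i \<inter> U j = {}" if "j \<in> I" for j
    using insert.prems insert.hyps that by (auto simp: disjoint_family_on_def)
  have IH: "glue I U f \<in> Rist G (\<Union>i\<in>I. U i)" using insert dI by auto
  have s: "supp_in (f i) (U i)" using insert.prems G by (auto intro: Rist_supp_in)
  have t: "supp_in (glue I U f) (\<Union>i\<in>I. U i)" using IH G by (auto intro: Rist_supp_in)
  have "glue (insert i I) U f x = f i (glue I U f x)" for x
  proof (cases "x \<in> (\<Union>i\<in>I. U i)")
    case True
    then obtain j where j: "j \<in> I" "x \<in> U j" by auto
    have "glue I U f x \<in> (\<Union>i\<in>I. U i)" using supp_in_mem[OF t] True by blast
    then have "glue I U f x \<notin> U i" using disj by auto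
    then have "f i (glue I U f x) = glue I U f x" using s supp_in_fix by metis
    also have "\<dots> = glue (insert i I) U f x"
      using j dI insert.prems by (simp add: glue_in[of _ _ j])
    finally show ?thesis by simp
  next
    case False
    then have g: "glue I U f x = x" by (intro glue_out) auto
    show ?thesis
    proof (cases "x \<in> U i")
      case True then show ?thesis using g insert.prems by (simp add: glue_in[of _ _ i])
    next
      case F2: False
      then have "glue (insert i I) U f x = x" using False by (intro glue_out) auto
      then show ?thesis using g s F2 by (simp add: supp_in_fix)
    qed
  qed
  then have "glue (insert i I) U f = f i \<circ> glue I U f" by auto
  moreover have "f i \<in> Rist G (\<Union>i\<in>insert i I. U i)"
    using insert.prems Rist_mono[of "U i" "\<Union>i\<in>insert i I. U i" G] by auto
  moreover have "glue I U f \<in> Rist G (\<Union>i\<in>insert i I. U i)"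
    using IH Rist_mono[of "\<Union>i\<in>I. U i" "\<Union>i\<in>insert i I. U i" G] by auto
  ultimately show ?case using Rist_comp[OF G] by metis
qed

section \<open>Disjoint and displaced open sets in a Hausdorff space\<close>

lemma finite_points_separated:
  fixes F :: "'a::t2_space set"
  assumes "finite F"
  obtains W where "\<And>y. y \<in> F \<Longrightarrow> open (W y)" "\<And>y. y \<in> F \<Longrightarrow> y \<in> W y" "disjoint_family_on W F"
proof -
  have "\<forall>x y::'a. \<exists>U V. x \<noteq> y \<longrightarrow> open U \<and> open V \<and> x \<in> U \<and> y \<in> V \<and> U \<inter> V = {}"
    using hausdorff by metis
  then obtain A B where AB: "\<And>x y::'a. x \<noteq> y \<Longrightarrow>
    open (A x y) \<and> open (B x y) \<and> x \<in> A x y \<and> y \<in> B x y \<and> A x y \<inter> B x y = {}"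
    by metis
  \<comment> \<open>\<open>y\<close> takes its side of the separation of \<open>(y, z)\<close> and
    of \<open>(z, y)\<close>, so for any two points of \<open>F\<close> both sides of one and the
    same separation are used.\<close>
  define W where "W y = (\<Inter>z\<in>F - {y}. A y z \<inter> B z y)" for y
  show ?thesis
  proof
    show "open (W y)" if "y \<in> F" for y
      unfolding W_def using assms AB by (intro open_INT) auto
    show "y \<in> W y" if "y \<in> F" for y
      unfolding W_def
    proof (rule INT_I)
      fix z assume "z \<in> F - {y}"
      then show "y \<in> A y z \<inter> B z y" using AB[of y z] AB[of z y] by auto
    qed
    show "disjoint_family_on W F"
      unfolding disjoint_family_on_def
    proof (intro ballI impI)
      fix y z assume yz: "y \<in> F" "z \<in> F" "y \<noteq> z"
      then have "W y \<subseteq> A y z" "W z \<subseteq> B y z" unfolding W_def by auto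
      then show "W y \<inter> W z = {}" using AB[of y z] yz(3) by blast
    qed
  qed
qed

lemma disjoint_open_subsets:
  fixes V :: "'a::t2_space set"
  assumes "open V" "infinite V" "finite J"
  obtains W where "\<And>j. j \<in> J \<Longrightarrow> open (W j)" "\<And>j. j \<in> J \<Longrightarrow> W j \<noteq> {}"
    "\<And>j. j \<in> J \<Longrightarrow> W j \<subseteq> V" "disjoint_family_on W J"
proof -
  obtain F where F: "F \<subseteq> V" "finite F" "card F = card J"
    using infinite_arbitrarily_large[OF assms(2)] by metis
  then obtain x where x: "bij_betw x J F"
    using assms(3) finite_same_card_bij by metis
  obtain W where W: "\<And>y. y \<in> F \<Longrightarrow> open (W y)" "\<And>y. y \<in> F \<Longrightarrow> y \<in> W y" "disjoint_family_on W F"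
    using finite_points_separated[OF F(2)] by metis
  have xF: "x j \<in> F" if "j \<in> J" for j using x that by (auto simp: bij_betw_def)
  show ?thesis
  proof
    show "open (W (x j) \<inter> V)" if "j \<in> J" for j using W xF that assms by auto
    show "W (x j) \<inter> V \<noteq> {}" if "j \<in> J" for j using W(2) xF that F by blast
    show "W (x j) \<inter> V \<subseteq> V" for j by auto
    show "disjoint_family_on (\<lambda>j. W (x j) \<inter> V) J"
      unfolding disjoint_family_on_def
    proof (intro ballI impI)
      fix i j assume "i \<in> J" "j \<in> J" "i \<noteq> j"
      then have "x i \<noteq> x j" using x by (auto simp: bij_betw_def inj_on_def)
      then show "W (x i) \<inter> V \<inter> (W (x j) \<inter> V) = {}"
        using W(3) xF \<open>i \<in> J\<close> \<open>j \<in> J\<close> by (fastforce simp: disjoint_family_on_def)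
    qed
  qed
qed

text \<open>A finite non-empty open set in a Hausdorff space contains an open singleton, and a
  bijection supported in one point is the identity, so the rigid stabilizer of that singleton would
  be abelian.\<close>

lemma open_infinite:
  fixes G :: "('a::t2_space \<Rightarrow> 'a) set"
  assumes G: "homeo_subgroup G"
    and ncomm: "\<And>V. open V \<Longrightarrow> V \<noteq> {} \<Longrightarrow> \<exists>a\<in>Rist G V. \<exists>b\<in>Rist G V. a \<circ> b \<noteq> b \<circ> a"
    and V: "open (V :: 'a set)" "V \<noteq> {}"
  shows "infinite V"
proof
  assume "finite V"
  obtain x where "x \<in> V" using V by auto
  have "closed (V - {x})" by (rule finite_imp_closed) (use \<open>finite V\<close> in auto)
  then have "open (V - (V - {x}))" using V by (intro open_Diff)
  moreover have "V - (V - {x}) = {x}" using \<open>x \<in> V\<close> by auto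
  ultimately have "open {x}" by simp
  then obtain a b where ab: "a \<in> Rist G {x}" "b \<in> Rist G {x}" "a \<circ> b \<noteq> b \<circ> a"
    using ncomm[of "{x}"] by auto
  have "g = id" if "g \<in> Rist G {x}" for g
  proof
    fix y
    have s: "supp_in g {x}" using that G by (rule Rist_supp_in[rotated])
    show "g y = id y" using supp_in_mem[OF s, of y] supp_in_fix[OF s, of y] by (cases "y = x") auto
  qed
  then show False using ab by auto
qed

text \<open>Greedy choice: the points moved by \<open>P i\<close> form an infinite open set, and
  each new point has to avoid only finitely many values.\<close>

lemma displaced_points:
  fixes P :: "'i \<Rightarrow> 'a::t2_space \<Rightarrow> 'a"
  assumes inf: "\<And>V::'a set. open V \<Longrightarrow> V \<noteq> {} \<Longrightarrow> infinite V"
    and "finite I" "\<And>i. i \<in> I \<Longrightarrow> homeo (P i)" "\<And>i. i \<in> I \<Longrightarrow> P i \<noteq> id"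
  shows "\<exists>x. inj_on x I \<and> (\<forall>i\<in>I. \<forall>j\<in>I. P i (x i) \<noteq> x j)"
  using assms(2-)
proof (induction I)
  case empty
  show ?case by simp
next
  case (insert i I)
  then obtain x where x: "inj_on x I" "\<forall>i\<in>I. \<forall>j\<in>I. P i (x i) \<noteq> x j" by auto
  let ?M = "{y. P i y \<noteq> y}"
  \<comment> \<open>The three parts rule out that the new point is an earlier point, is the image of
    an earlier point, or is mapped to an earlier point.\<close>
  let ?B = "x ` I \<union> (\<lambda>j. P j (x j)) ` I \<union> inv (P i) ` x ` I"
  have h: "bij (P i)" "continuous_on UNIV (P i)" using insert.prems by (auto simp: homeo_def)
  have "open ?M" by (intro open_Collect_neq h continuous_on_id)
  moreover have "?M \<noteq> {}" using insert.prems(2)[of i] by (auto simp: fun_eq_iff)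
  ultimately have "infinite ?M" using inf by blast
  then have "infinite (?M - ?B)" using insert.hyps by (intro Diff_infinite_finite) auto
  then obtain y where y: "y \<in> ?M - ?B" by (metis finite.emptyI equals0I)
  have Py: "P i y \<noteq> x j" if "j \<in> I" for j
  proof
    assume "P i y = x j"
    then have "y = inv (P i) (x j)" using bij_cancel(1)[OF h(1), of y] by simp
    then show False using y that by auto
  qed
  have Pj: "P j (x j) \<noteq> y" if "j \<in> I" for j using y that by auto
  have "inj_on (x(i := y)) (insert i I)"
    using x(1) y insert.hyps by (auto simp: inj_on_def)
  moreover have "\<forall>k\<in>insert i I. \<forall>j\<in>insert i I. P k ((x(i := y)) k) \<noteq> (x(i := y)) j"
    using x(2) y Py Pj insert.hyps by auto
  ultimately show ?case by blast
qed

text \<open>Continuity turns displaced points into displaced neighbourhoods: \<open>P i\<close> maps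
  \<open>U i\<close> into a neighbourhood of \<open>P i (x i)\<close> that is disjoint from those of
  all \<open>x j\<close>. Two images \<open>P i (x i)\<close> may coincide, since they are never
  compared with each other.\<close>

lemma displaced_open_sets:
  fixes P :: "'i \<Rightarrow> 'a::t2_space \<Rightarrow> 'a"
  assumes inf: "\<And>V::'a set. open V \<Longrightarrow> V \<noteq> {} \<Longrightarrow> infinite V"
    and I: "finite I" and P: "\<And>i. i \<in> I \<Longrightarrow> homeo (P i)" "\<And>i. i \<in> I \<Longrightarrow> P i \<noteq> id"
  obtains U where "\<And>i. i \<in> I \<Longrightarrow> open (U i)" "\<And>i. i \<in> I \<Longrightarrow> U i \<noteq> {}" "disjoint_family_on U I"
    "\<And>i j. i \<in> I \<Longrightarrow> j \<in> I \<Longrightarrow> P i ` U i \<inter> U j = {}"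
proof -
  obtain x where x: "inj_on x I" "\<And>i j. i \<in> I \<Longrightarrow> j \<in> I \<Longrightarrow> P i (x i) \<noteq> x j"
    using displaced_points[of I P, OF inf I P] by auto
  let ?F = "x ` I \<union> (\<lambda>i. P i (x i)) ` I"
  have finF: "finite ?F" using I by simp
  obtain W where W: "\<And>y. y \<in> ?F \<Longrightarrow> open (W y)" "\<And>y. y \<in> ?F \<Longrightarrow> y \<in> W y" "disjoint_family_on W ?F"
    by (rule finite_points_separated[OF finF]) (rule that)
  define U where "U i = W (x i) \<inter> P i -` W (P i (x i))" for i
  have disj: "W y \<inter> W z = {}" if "y \<in> ?F" "z \<in> ?F" "y \<noteq> z" for y z
    using W(3) that unfolding disjoint_family_on_def by blast
  show ?thesis
  proof
    show "open (U i)" if "i \<in> I" for i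
      unfolding U_def using that W(1) P(1)[OF that]
      by (intro open_Int open_vimage) (auto simp: homeo_def)
    show "U i \<noteq> {}" if "i \<in> I" for i
      unfolding U_def using that W(2)[of "x i"] W(2)[of "P i (x i)"] by auto
    show "disjoint_family_on U I"
      unfolding disjoint_family_on_def
    proof (intro ballI impI)
      fix i j assume "i \<in> I" "j \<in> I" "i \<noteq> j"
      then have "x i \<noteq> x j" using x(1) by (auto simp: inj_on_def)
      then have "W (x i) \<inter> W (x j) = {}" using disj \<open>i \<in> I\<close> \<open>j \<in> I\<close> by blast
      then show "U i \<inter> U j = {}" by (auto simp: U_def)
    qed
    show "P i ` U i \<inter> U j = {}" if "i \<in> I" "j \<in> I" for i j
    proof -
      have "W (P i (x i)) \<inter> W (x j) = {}" using disj x(2) that by blast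
      then show ?thesis by (auto simp: U_def)
    qed
  qed
qed

subsection \<open>Counting\<close>

text \<open>Slicing the product along coordinate \<open>i\<close> shows that \<open>A i\<close> has
  density below \<open>1 / card I\<close> in it, and \<open>card I\<close> such sets cannot fill the
  product.\<close>

lemma not_covered_by_sparse_fibres:
  fixes T :: "'i \<Rightarrow> 'b set" and A :: "'i \<Rightarrow> ('i \<Rightarrow> 'b) set"
  assumes I: "finite I" "I \<noteq> {}" and T: "\<And>i. i \<in> I \<Longrightarrow> finite (T i)" "\<And>i. i \<in> I \<Longrightarrow> T i \<noteq> {}"
    and sparse: "\<And>i f. i \<in> I \<Longrightarrow> f \<in> PiE I T \<Longrightarrow> card {t\<in>T i. f(i := t) \<in> A i} * card I < card (T i)"
  shows "\<not> PiE I T \<subseteq> (\<Union>i\<in>I. A i)"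
proof
  assume cover: "PiE I T \<subseteq> (\<Union>i\<in>I. A i)"
  have fin: "finite (PiE J T)" if "J \<subseteq> I" for J
    using that I T by (intro finite_PiE) (auto intro: finite_subset)
  have ne: "PiE J T \<noteq> {}" if "J \<subseteq> I" for J
    using that T by (auto simp: PiE_eq_empty_iff)
  have slice: "card (A i \<inter> PiE I T) * card I < card (PiE I T)" if i: "i \<in> I" for i
  proof -
    let ?J = "I - {i}"
    let ?F = "\<lambda>g. {t\<in>T i. g(i := t) \<in> A i}"
    have PI: "PiE I T = (\<lambda>(t, g). g(i := t)) ` (T i \<times> PiE ?J T)"
      using PiE_insert_eq[of i ?J T] i by (simp add: insert_absorb)
    then have "A i \<inter> PiE I T \<subseteq> (\<Union>g\<in>PiE ?J T. (\<lambda>t. g(i := t)) ` ?F g)"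
      by auto
    then have "card (A i \<inter> PiE I T) \<le> card (\<Union>g\<in>PiE ?J T. (\<lambda>t. g(i := t)) ` ?F g)"
      using fin[of ?J] T i by (intro card_mono) auto
    also have "\<dots> \<le> (\<Sum>g\<in>PiE ?J T. card ((\<lambda>t. g(i := t)) ` ?F g))"
      using fin[of ?J] by (intro card_UN_le) auto
    also have "\<dots> \<le> (\<Sum>g\<in>PiE ?J T. card (?F g))"
      using T i by (intro sum_mono card_image_le) auto
    finally have "card (A i \<inter> PiE I T) * card I \<le> (\<Sum>g\<in>PiE ?J T. card (?F g) * card I)"
      unfolding sum_distrib_right[symmetric] by (rule mult_le_mono1)
    also have "\<dots> < (\<Sum>g\<in>PiE ?J T. card (T i))"
    proof (intro sum_strict_mono fin ne)
      fix g assume g: "g \<in> PiE ?J T"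
      \<comment> \<open>The base point \<open>g\<close> lacks coordinate \<open>i\<close>, while
        \<open>sparse\<close> speaks of full families. Any \<open>t\<close> fills the gap, since
        that coordinate is overwritten anyway.\<close>
      obtain t where "t \<in> T i" using T i by auto
      then have "g(i := t) \<in> PiE I T" using g PI by force
      from sparse[OF i this] show "card (?F g) * card I < card (T i)" by simp
    qed auto
    also have "\<dots> = card (PiE I T)"
      using i I by (simp add: card_PiE prod.remove[of I i])
    finally show ?thesis .
  qed
  have "PiE I T = (\<Union>i\<in>I. A i \<inter> PiE I T)" using cover by auto
  then have "card (PiE I T) \<le> (\<Sum>i\<in>I. card (A i \<inter> PiE I T))"
    using card_UN_le[OF I(1), of "\<lambda>i. A i \<inter> PiE I T"] by simp
  then have "card (PiE I T) * card I \<le> (\<Sum>i\<in>I. card (A i \<inter> PiE I T) * card I)"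
    unfolding sum_distrib_right[symmetric] by (rule mult_le_mono1)
  also have "\<dots> < (\<Sum>i\<in>I. card (PiE I T))"
    using I slice by (intro sum_strict_mono) auto
  finally show False by (simp add: mult.commute)
qed

text \<open>Choose two rows in each column with at least two points. Without rectangles these pairs
  differ, so there are at most \<open>(R + 1)^2\<close> such columns, with at most
  \<open>(R + 1)^3\<close> points in all; the other columns hold at most one point each. The grid
  has \<open>R * (R + 1)^3 + 1\<close> columns, just more than \<open>R\<close> times the
  exceptional points.\<close>

lemma rectangle_free_sparse:
  fixes Z :: "(nat \<times> nat) set"
  assumes Z: "Z \<subseteq> {..R} \<times> {..R * (R + 1) ^ 3}"
    and free: "\<And>k k' l l'. \<lbrakk>(k, l) \<in> Z; (k', l) \<in> Z; (k, l') \<in> Z; (k', l') \<in> Z; k \<noteq> k'\<rbrakk> \<Longrightarrow> l = l'"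
  shows "card Z * R < card ({..R} \<times> {..R * (R + 1) ^ 3})"
proof -
  let ?Q = "{..R * (R + 1) ^ 3}"
  let ?D = "\<lambda>l. {k. (k, l) \<in> Z}"
  let ?B = "{l\<in>?Q. card (?D l) \<ge> 2}"
  have D: "?D l \<subseteq> {..R}" for l using Z by auto
  have finD: "finite (?D l)" for l using D finite_subset by blast
  have cD: "card (?D l) \<le> R + 1" for l using card_mono[OF _ D[of l]] by simp
  have "\<exists>e. fst e \<noteq> snd e \<and> fst e \<in> ?D l \<and> snd e \<in> ?D l" if "l \<in> ?B" for l
  proof -
    have "\<not> card (?D l) \<le> Suc 0" using that by auto
    then show "\<exists>e. fst e \<noteq> snd e \<and> fst e \<in> ?D l \<and> snd e \<in> ?D l"
      using card_le_Suc0_iff_eq[OF finD[of l]] by auto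
  qed
  then have "\<forall>l\<in>?B. \<exists>e. fst e \<noteq> snd e \<and> fst e \<in> ?D l \<and> snd e \<in> ?D l" by blast
  from bchoice[OF this] obtain e where
    e: "\<And>l. l \<in> ?B \<Longrightarrow> fst (e l) \<noteq> snd (e l) \<and> fst (e l) \<in> ?D l \<and> snd (e l) \<in> ?D l"
    by blast
  have "inj_on e ?B"
  proof (rule inj_onI)
    fix l l' assume l: "l \<in> ?B" "l' \<in> ?B" "e l = e l'"
    have "(fst (e l), l) \<in> Z" "(snd (e l), l) \<in> Z" "fst (e l) \<noteq> snd (e l)"
      "(fst (e l), l') \<in> Z" "(snd (e l), l') \<in> Z"
      using e[OF l(1)] e[OF l(2)] unfolding l(3) by blast+
    then show "l = l'" using free by metis
  qed
  moreover have "e ` ?B \<subseteq> {..R} \<times> {..R}"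
  proof
    fix z assume "z \<in> e ` ?B"
    then obtain l where "l \<in> ?B" "z = e l" by blast
    then have "fst z \<in> {..R}" "snd z \<in> {..R}" using e[of l] D[of l] by blast+
    then show "z \<in> {..R} \<times> {..R}" by (simp add: mem_Times_iff)
  qed
  ultimately have "card ?B \<le> card ({..R} \<times> {..R})" by (intro card_inj_on_le) auto
  then have B: "card ?B \<le> (R + 1) * (R + 1)" by (simp add: card_cartesian_product)
  have "Z = (\<Union>l\<in>?Q. (\<lambda>k. (k, l)) ` ?D l)" using Z by auto
  then have "card Z \<le> (\<Sum>l\<in>?Q. card ((\<lambda>k. (k, l)) ` ?D l))"
    using card_UN_le[of ?Q "\<lambda>l. (\<lambda>k. (k, l)) ` ?D l"] by simp
  also have "\<dots> \<le> (\<Sum>l\<in>?Q. card (?D l))"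
    by (intro sum_mono card_image_le finD)
  also have "\<dots> \<le> (\<Sum>l\<in>?Q. 1 + (if card (?D l) \<ge> 2 then R + 1 else 0))"
  proof (intro sum_mono)
    fix l assume "l \<in> ?Q"
    then show "card (?D l) \<le> 1 + (if card (?D l) \<ge> 2 then R + 1 else 0)"
      using cD[of l] by auto
  qed
  also have "\<dots> = card ?Q + card ?B * (R + 1)"
    unfolding sum.distrib sum.inter_filter[symmetric, OF finite_atMost] by simp
  also have "\<dots> \<le> card ?Q + (R + 1) * (R + 1) * (R + 1)"
    using B by (intro add_left_mono mult_right_mono) auto
  finally have "card Z * R \<le> (card ?Q + (R + 1) * (R + 1) * (R + 1)) * R"
    by (rule mult_le_mono1)
  also have "\<dots> = card ?Q * R + R * (R + 1) ^ 3" by (simp add: algebra_simps power3_eq_cube)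
  also have "\<dots> < card ?Q * R + card ?Q" by simp
  finally show ?thesis by (simp add: card_cartesian_product algebra_simps)
qed

subsection \<open>Commutators\<close>

text \<open>Splits off coordinate \<open>i\<close> as the right-hand factor, giving the shape
  \<open>\<beta> \<circ> w\<close> of \<open>conj_quotient_mem\<close>.\<close>

lemma glue_upd:
  assumes disj: "disjoint_family_on U I" and i: "i \<in> I" and w: "supp_in w (U i)"
  shows "glue I U (f(i := w)) = glue (I - {i}) U f \<circ> w"
proof
  fix x
  have d': "disjoint_family_on U (I - {i})" using disj by (auto simp: disjoint_family_on_def)
  have off: "x \<notin> U j" if "x \<in> U i" "j \<in> I" "j \<noteq> i" for j x
    using disj i that unfolding disjoint_family_on_def by blast
  consider "x \<in> U i" | j where "j \<in> I" "j \<noteq> i" "x \<in> U j" | "\<forall>j\<in>I. x \<notin> U j" by blast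
  then show "glue I U (f(i := w)) x = (glue (I - {i}) U f \<circ> w) x"
  proof cases
    case 1
    then have wx: "w x \<in> U i" using supp_in_mem[OF w] by simp
    have "glue (I - {i}) U f (w x) = w x" using off[OF wx] by (intro glue_out) auto
    then show ?thesis using glue_in[OF disj i 1, of "f(i := w)"] by simp
  next
    case 2
    then have "w x = x" using off supp_in_fix[OF w, of x] by blast
    then show ?thesis
      using 2 glue_in[OF disj, of j x "f(i := w)"] glue_in[OF d', of j x f] by simp
  next
    case 3
    then have "w x = x" using i supp_in_fix[OF w, of x] by blast
    then show ?thesis using 3 glue_out[of I x U] glue_out[of "I - {i}" x U] by simp
  qed
qed

text \<open>Each pair \<open>(k, l)\<close> gets its own open set with a non-commuting pair of
  elements on it; \<open>s k\<close> glues the first elements along row \<open>k\<close>, and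
  \<open>v l\<close> the second ones along column \<open>l\<close>.\<close>

lemma noncommuting_families:
  fixes U :: "'a::t2_space set"
  assumes G: "homeo_subgroup G"
    and ncomm: "\<And>V. open V \<Longrightarrow> V \<noteq> {} \<Longrightarrow> \<exists>a\<in>Rist G V. \<exists>b\<in>Rist G V. a \<circ> b \<noteq> b \<circ> a"
    and U: "open U" "infinite U" and fin: "finite A" "finite B"
  obtains s v where "\<And>k. s k \<in> Rist G U" "\<And>l. v l \<in> Rist G U"
    "\<And>k k' l l'. \<lbrakk>k \<in> A; k' \<in> A; l \<in> B; l' \<in> B; k \<noteq> k'; l \<noteq> l'\<rbrakk> \<Longrightarrow>
       (inv (s k) \<circ> s k') \<circ> (v l \<circ> inv (v l')) \<noteq> (v l \<circ> inv (v l')) \<circ> (inv (s k) \<circ> s k')"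
proof -
  let ?J = "A \<times> B"
  have finJ: "finite ?J" using fin by simp
  obtain W where W: "\<And>j. j \<in> ?J \<Longrightarrow> open (W j)" "\<And>j. j \<in> ?J \<Longrightarrow> W j \<noteq> {}"
    "\<And>j. j \<in> ?J \<Longrightarrow> W j \<subseteq> U" "disjoint_family_on W ?J"
    by (rule disjoint_open_subsets[OF U finJ]) (rule that)
  have "\<forall>j\<in>?J. \<exists>e. fst e \<in> Rist G (W j) \<and> snd e \<in> Rist G (W j) \<and> fst e \<circ> snd e \<noteq> snd e \<circ> fst e"
  proof
    fix j assume "j \<in> ?J"
    then obtain a b where "a \<in> Rist G (W j)" "b \<in> Rist G (W j)" "a \<circ> b \<noteq> b \<circ> a"
      using ncomm[OF W(1,2)] by blast
    then show "\<exists>e. fst e \<in> Rist G (W j) \<and> snd e \<in> Rist G (W j) \<and> fst e \<circ> snd e \<noteq> snd e \<circ> fst e"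
      by (intro exI[of _ "(a, b)"]) simp
  qed
  from bchoice[OF this] obtain e where e: "\<And>j. j \<in> ?J \<Longrightarrow> fst (e j) \<in> Rist G (W j)"
    "\<And>j. j \<in> ?J \<Longrightarrow> snd (e j) \<in> Rist G (W j)"
    "\<And>j. j \<in> ?J \<Longrightarrow> fst (e j) \<circ> snd (e j) \<noteq> snd (e j) \<circ> fst (e j)"
    by blast
  define s where "s k = glue ?J W (\<lambda>j. if fst j = k then fst (e j) else id)" for k
  define v where "v l = glue ?J W (\<lambda>j. if snd j = l then snd (e j) else id)" for l
  have sub: "Rist G (\<Union>j\<in>?J. W j) \<subseteq> Rist G U" using W(3) by (intro Rist_mono) blast
  have s: "s k \<in> Rist G U" for k
    unfolding s_def using e(1) by (intro subsetD[OF sub] glue_Rist G finJ W(4)) (auto simp: Rist_id[OF G])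
  have v: "v l \<in> Rist G U" for l
    unfolding v_def using e(2) by (intro subsetD[OF sub] glue_Rist G finJ W(4)) (auto simp: Rist_id[OF G])
  have bij_s: "bij (s k)" and bij_v: "bij (v l)" for k l
    using supp_in_bij[OF Rist_supp_in[OF G s]] supp_in_bij[OF Rist_supp_in[OF G v]] by auto
  show ?thesis
  proof (rule that[OF s v], rule notI)
    fix k k' l l' assume kl: "k \<in> A" "k' \<in> A" "l \<in> B" "l' \<in> B" "k \<noteq> k'" "l \<noteq> l'"
      and eq: "(inv (s k) \<circ> s k') \<circ> (v l \<circ> inv (v l')) = (v l \<circ> inv (v l')) \<circ> (inv (s k) \<circ> s k')"
    define j where "j = (k, l)"
    have j: "j \<in> ?J" using kl by (simp add: j_def)
    define y where "y = fst (e j)"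
    define z where "z = snd (e j)"
    have sy: "supp_in y (W j)" and sz: "supp_in z (W j)"
      using e(1,2)[OF j] Rist_supp_in[OF G] by (auto simp: y_def z_def)
    \<comment> \<open>On \<open>W (k, l)\<close> the elements \<open>s k'\<close> and
      \<open>v l'\<close> are trivial, so there the two quotients act as \<open>inv y\<close> and
      \<open>z\<close>, and their commuting would make \<open>y\<close> and \<open>z\<close>
      commute.\<close>
    have on: "s k x = y x" "s k' x = x" "v l x = z x" "v l' x = x" if "x \<in> W j" for x
      unfolding s_def v_def glue_in[OF W(4) j that] using kl by (auto simp: j_def y_def z_def)
    have ivs: "inv (s k) (y x) = x" if "x \<in> W j" for x
      using bij_cancel(1)[OF bij_s, of k x] on(1)[OF that] by simp
    have ivv: "inv (v l') x = x" if "x \<in> W j" for x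
      using bij_cancel(1)[OF bij_v, of l' x] on(4)[OF that] by simp
    have "y (z x) = z (y x)" for x
    proof (cases "x \<in> W j")
      case True
      have yx: "y x \<in> W j" "z x \<in> W j" "z (y x) \<in> W j"
        using True by (simp_all add: supp_in_mem[OF sy] supp_in_mem[OF sz])
      have "inv (s k) (s k' (v l (inv (v l') (y x)))) = v l (inv (v l') (inv (s k) (s k' (y x))))"
        using fun_cong[OF eq, of "y x"] by simp
      then have "inv (s k) (z (y x)) = z x"
        using True yx by (simp add: ivv on ivs)
      then have "s k (z x) = z (y x)" using bij_cancel(2)[OF bij_s, of k "z (y x)"] by simp
      then show ?thesis using yx by (simp add: on)
    next
      case False then show ?thesis using supp_in_fix[OF sy] supp_in_fix[OF sz] by simp
    qed
    then show False using e(3)[OF j] by (auto simp: y_def z_def fun_eq_iff)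
  qed
qed

text \<open>For disjoint \<open>U\<close> and \<open>p U\<close>: the projection of \<open>H \<inter> (Sym(U) \<times> Sym(p U))\<close> to the first factor.\<close>

definition proj_group :: "('a \<Rightarrow> 'a) set \<Rightarrow> ('a \<Rightarrow> 'a) \<Rightarrow> 'a set \<Rightarrow> ('a \<Rightarrow> 'a) set" where
  "proj_group H p U = {a. supp_in a U \<and> (\<exists>c. supp_in c (p ` U) \<and> a \<circ> c \<in> H)}"

lemma supp_in_id: "supp_in id A"
  by (simp add: supp_in_def)

lemma proj_group_id: "homeo_subgroup H \<Longrightarrow> id \<in> proj_group H p U"
  using supp_in_id homeo_subgroup_id by (force simp: proj_group_def)

lemma proj_group_inv_comp:
  assumes H: "homeo_subgroup H" and disj: "p ` U \<inter> U = {}"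
    and x: "x \<in> proj_group H p U" and y: "y \<in> proj_group H p U"
  shows "inv y \<circ> x \<in> proj_group H p U"
proof -
  obtain c where c: "supp_in x U" "supp_in c (p ` U)" "x \<circ> c \<in> H"
    using x by (auto simp: proj_group_def)
  obtain d where d: "supp_in y U" "supp_in d (p ` U)" "y \<circ> d \<in> H"
    using y by (auto simp: proj_group_def)
  have s: "supp_in (inv y \<circ> x) U" "supp_in (inv d \<circ> c) (p ` U)"
    using c d by (auto intro: supp_in_comp supp_in_inv)
  have "inv (y \<circ> d) \<circ> (x \<circ> c) \<in> H"
    by (rule homeo_subgroup_comp[OF H homeo_subgroup_inv[OF H d(3)] c(3)])
  moreover have "inv (y \<circ> d) \<circ> (x \<circ> c) = (inv y \<circ> x) \<circ> (inv d \<circ> c)"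
  proof
    fix u
    have "inv d (inv y (x w)) = inv y (x (inv d w))" for w
      using supp_in_commute[OF supp_in_inv[OF d(2)] s(1) disj, of w] by simp
    then show "(inv (y \<circ> d) \<circ> (x \<circ> c)) u = ((inv y \<circ> x) \<circ> (inv d \<circ> c)) u"
      by (simp add: o_inv_distrib[OF supp_in_bij[OF d(1)] supp_in_bij[OF d(2)]])
  qed
  ultimately show ?thesis using s by (auto simp: proj_group_def)
qed

lemma proj_group_inv:
  assumes "homeo_subgroup H" "p ` U \<inter> U = {}" "x \<in> proj_group H p U"
  shows "inv x \<in> proj_group H p U"
  using proj_group_inv_comp[OF assms(1,2) proj_group_id[OF assms(1)] assms(3)] by simp

section \<open>Elements of \<open>H\<close> obtained from conjugates and commutators\<close>

lemma inv_conj: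
  fixes p g :: "'a \<Rightarrow> 'a"
  assumes "bij p" "bij g"
  shows "inv (inv g \<circ> p \<circ> g) = inv g \<circ> inv p \<circ> g"
  by (rule inv_unique_comp) (simp_all add: fun_eq_iff bij_cancel assms)

text \<open>Multiply the first member of \<open>H\<close> by the inverse of the second. The outer
  factor \<beta> cancels because it commutes with \<open>w \<circ> inv w'\<close> and with the
  conjugate of that by \<open>p\<close>; this conjugate also moves past \<open>w'\<close>.\<close>

lemma conj_quotient_mem:
  assumes H: "homeo_subgroup H" and p: "bij p" and w: "supp_in w U" "supp_in w' U" and \<beta>: "supp_in \<beta> B"
    and disj: "U \<inter> B = {}" "p ` U \<inter> (U \<union> B) = {}"
    and mem: "inv (\<beta> \<circ> w) \<circ> p \<circ> (\<beta> \<circ> w) \<in> H" "inv (\<beta> \<circ> w') \<circ> p \<circ> (\<beta> \<circ> w') \<in> H"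
  shows "inv w \<circ> w' \<circ> (p \<circ> (w \<circ> inv w') \<circ> inv p) \<in> H"
proof -
  define e where "e = p \<circ> (w \<circ> inv w') \<circ> inv p"
  have bij: "bij w" "bij w'" "bij \<beta>" using w \<beta> supp_in_bij by auto
  have d: "supp_in (w \<circ> inv w') U" using w by (intro supp_in_comp supp_in_inv)
  have e: "supp_in e (p ` U)" unfolding e_def by (rule supp_in_conj[OF d p])
  have c1: "\<beta> (w (inv w' x)) = w (inv w' (\<beta> x))" for x
    using supp_in_commute[OF d \<beta> disj(1), of x] by simp
  have c2: "e (\<beta> x) = \<beta> (e x)" for x using supp_in_commute[OF e \<beta>] disj by blast
  have c3: "e (w' x) = w' (e x)" for x using supp_in_commute[OF e w(2)] disj by blast
  have e': "p (w (inv w' (inv p x))) = e x" for x by (simp add: e_def)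
  have "(inv (\<beta> \<circ> w) \<circ> p \<circ> (\<beta> \<circ> w)) \<circ> inv (inv (\<beta> \<circ> w') \<circ> p \<circ> (\<beta> \<circ> w')) = inv w \<circ> w' \<circ> e"
  proof
    fix x
    have bs: "bij (\<beta> \<circ> w)" "bij (\<beta> \<circ> w')" using bij by (auto intro: bij_comp)
    have "inv (inv (\<beta> \<circ> w') \<circ> p \<circ> (\<beta> \<circ> w')) = inv (\<beta> \<circ> w') \<circ> inv p \<circ> (\<beta> \<circ> w')"
      by (rule inv_conj[OF p bs(2)])
    then have "((inv (\<beta> \<circ> w) \<circ> p \<circ> (\<beta> \<circ> w)) \<circ> inv (inv (\<beta> \<circ> w') \<circ> p \<circ> (\<beta> \<circ> w'))) x
      = inv w (inv \<beta> (p (\<beta> (w (inv w' (inv \<beta> (inv p (\<beta> (w' x)))))))))"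
      using bij by (simp add: o_inv_distrib)
    also have "\<dots> = inv w (w' (e x))"
      using bij by (simp add: c1 bij_cancel e' c2 c3)
    finally show "((inv (\<beta> \<circ> w) \<circ> p \<circ> (\<beta> \<circ> w)) \<circ> inv (inv (\<beta> \<circ> w') \<circ> p \<circ> (\<beta> \<circ> w'))) x = (inv w \<circ> w' \<circ> e) x"
      by simp
  qed
  then show ?thesis using homeo_subgroup_comp[OF H mem(1) homeo_subgroup_inv[OF H mem(2)]]
    by (simp add: e_def)
qed

lemma conj_quotient_rectangle:
  assumes H: "homeo_subgroup H" and p: "bij p" and disj: "p ` U \<inter> U = {}"
    and w: "supp_in w1 U" "supp_in w2 U" "supp_in w3 U" "supp_in w4 U"
    and one: "w1 \<circ> inv w2 \<circ> w3 \<circ> inv w4 = id"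
    and mem: "inv w1 \<circ> w2 \<circ> (p \<circ> (w1 \<circ> inv w2) \<circ> inv p) \<in> H"
      "inv w3 \<circ> w4 \<circ> (p \<circ> (w3 \<circ> inv w4) \<circ> inv p) \<in> H"
  shows "inv w1 \<circ> w2 \<circ> inv w3 \<circ> w4 \<in> H"
proof -
  have "(inv w1 \<circ> w2 \<circ> (p \<circ> (w1 \<circ> inv w2) \<circ> inv p)) \<circ> (inv w3 \<circ> w4 \<circ> (p \<circ> (w3 \<circ> inv w4) \<circ> inv p))
    = inv w1 \<circ> w2 \<circ> inv w3 \<circ> w4"
  proof
    fix x
    have e: "supp_in (p \<circ> (w1 \<circ> inv w2) \<circ> inv p) (p ` U)" "supp_in (inv w3 \<circ> w4) U"
      using w p by (auto intro!: supp_in_comp supp_in_inv supp_in_conj)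
    have c: "p (w1 (inv w2 (inv p (inv w3 (w4 y))))) = inv w3 (w4 (p (w1 (inv w2 (inv p y)))))" for y
      using supp_in_commute[OF e disj, of y] by simp
    have o: "w1 (inv w2 (w3 (inv w4 y))) = y" for y using fun_cong[OF one, of y] by simp
    show "((inv w1 \<circ> w2 \<circ> (p \<circ> (w1 \<circ> inv w2) \<circ> inv p)) \<circ> (inv w3 \<circ> w4 \<circ> (p \<circ> (w3 \<circ> inv w4) \<circ> inv p))) x
      = (inv w1 \<circ> w2 \<circ> inv w3 \<circ> w4) x"
      by (simp add: c bij_cancel[OF p] o)
  qed
  then show ?thesis using homeo_subgroup_comp[OF H mem] by simp
qed

text \<open>The commutator of \<open>n\<close> with \<open>a \<circ> c\<close> does not see
  \<open>c\<close>, which lives in \<open>p\<close> U\<open>; it is\<close>m = e \<circ> inv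
  a\<open>with\<close>e\<open>supported in\<close>n \<open>V\<close>. The commutator of
  \<open>m\<close> with \<open>b \<circ> d\<close> sees neither \<open>d\<close> nor
  \<open>e\<close>, so it is that of \<open>inv a\<close> and \<open>b\<close>.\<close>

lemma double_commutator_mem:
  assumes H: "homeo_subgroup H" and disj: "p ` U \<inter> U = {}"
    and n: "n \<in> H" "supp_in n U" and V: "V \<subseteq> U" "n ` V \<inter> V = {}"
    and a: "a \<in> proj_group H p U" "supp_in a V" and b: "b \<in> proj_group H p U" "supp_in b V"
  shows "inv a \<circ> b \<circ> a \<circ> inv b \<in> H"
proof -
  obtain c where c: "supp_in c (p ` U)" "a \<circ> c \<in> H" using a by (auto simp: proj_group_def)
  obtain d where d: "supp_in d (p ` U)" "b \<circ> d \<in> H" using b by (auto simp: proj_group_def)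
  have aU: "supp_in a U" and bU: "supp_in b U" using a b V supp_in_mono by auto
  have bij: "bij a" "bij b" "bij c" "bij d" "bij n"
    using aU bU c d n supp_in_bij by auto
  define e where "e = n \<circ> a \<circ> inv n"
  define m where "m = e \<circ> inv a"
  define g where "g = inv a \<circ> b \<circ> a \<circ> inv b"
  have e: "supp_in e (n ` V)" unfolding e_def using a bij by (intro supp_in_conj)
  have g: "supp_in g V" unfolding g_def using a b by (intro supp_in_comp supp_in_inv)
  have m: "supp_in m U"
    unfolding m_def e_def using aU n by (intro supp_in_comp supp_in_inv)
  have "n \<circ> (a \<circ> c) \<circ> inv n \<circ> inv (a \<circ> c) = m"
  proof
    fix x
    have "c (inv n (inv c y)) = inv n y" for y
      using supp_in_commute[OF c(1) supp_in_inv[OF n(2)] disj, of "inv c y"] bij by (simp add: bij_cancel)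
    then show "(n \<circ> (a \<circ> c) \<circ> inv n \<circ> inv (a \<circ> c)) x = m x"
      using bij by (simp add: o_inv_distrib m_def e_def)
  qed
  then have mH: "m \<in> H"
    using homeo_subgroup_comp[OF H homeo_subgroup_comp[OF H homeo_subgroup_comp[OF H n(1) c(2)]
      homeo_subgroup_inv[OF H n(1)]] homeo_subgroup_inv[OF H c(2)]] by simp
  have "m \<circ> (b \<circ> d) \<circ> inv m \<circ> inv (b \<circ> d) = g"
  proof
    fix x
    have 1: "d (inv m (inv d y)) = inv m y" for y
      using supp_in_commute[OF d(1) supp_in_inv[OF m] disj, of "inv d y"] bij by (simp add: bij_cancel)
    have be: "bij e" by (rule supp_in_bij[OF e])
    then have im: "inv m = a \<circ> inv e"
      using bij by (simp add: m_def o_inv_distrib bij_imp_bij_inv inv_inv_eq)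
    have 2: "inv e (inv b y) = inv b (inv e y)" for y
      using supp_in_commute[OF supp_in_inv[OF e] supp_in_inv[OF b(2)]] V by blast
    have 3: "e (g y) = g (e y)" for y using supp_in_commute[OF e g] V by blast
    have "(m \<circ> (b \<circ> d) \<circ> inv m \<circ> inv (b \<circ> d)) x = m (b (inv m (inv b x)))"
      using bij 1 by (simp add: o_inv_distrib)
    also have "\<dots> = m (b (a (inv e (inv b x))))" by (simp add: im)
    also have "\<dots> = e (g (inv e x))" by (simp add: m_def 2 g_def)
    also have "\<dots> = g x" by (simp add: 3 bij_cancel[OF be])
    finally show "(m \<circ> (b \<circ> d) \<circ> inv m \<circ> inv (b \<circ> d)) x = g x" .
  qed
  then have "g \<in> H"
    using homeo_subgroup_comp[OF H homeo_subgroup_comp[OF H homeo_subgroup_comp[OF H mH d(2)]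
      homeo_subgroup_inv[OF H mH]] homeo_subgroup_inv[OF H d(2)]] by simp
  then show ?thesis by (simp add: g_def)
qed

section \<open>Test sets with sparse fibres\<close>

text \<open>If \<open>H\<close> meets the rigid stabilizer trivially, a grid of products works,
  since a rectangle in \<open>Z\<close> would give a non-trivial common element. If there are more
  than \<open>R\<close> distinct cosets, their representatives work, since \<open>Z\<close> then has
  at most one element.\<close>

lemma sparse_test_set:
  fixes U :: "'a::t2_space set"
  assumes G: "homeo_subgroup G" and H: "homeo_subgroup H"
    and ncomm: "\<And>V. open V \<Longrightarrow> V \<noteq> {} \<Longrightarrow> \<exists>a\<in>Rist G V. \<exists>b\<in>Rist G V. a \<circ> b \<noteq> b \<circ> a"
    and U: "open U" "infinite U" and p: "bij p" "p ` U \<inter> U = {}"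
    and small: "H \<inter> Rist G U \<subseteq> {id} \<or>
      (\<exists>T\<subseteq>Rist G U. finite T \<and> R < card T \<and>
        (\<forall>s\<in>T. \<forall>t\<in>T. inv s \<circ> t \<in> proj_group H p U \<longrightarrow> s = t))"
  shows "\<exists>T\<subseteq>Rist G U. finite T \<and> T \<noteq> {} \<and>
    (\<forall>Z\<subseteq>T. (\<forall>w\<in>Z. \<forall>w'\<in>Z. inv w \<circ> w' \<circ> (p \<circ> (w \<circ> inv w') \<circ> inv p) \<in> H)
       \<longrightarrow> card Z * R < card T)"
  using small
proof
  assume triv: "H \<inter> Rist G U \<subseteq> {id}"
  let ?B = "{..R * (R + 1) ^ 3}"
  let ?E = "{..R} \<times> ?B"
  have fin: "finite {..R}" "finite ?B" by simp_all
  obtain s v where s: "\<And>k::nat. s k \<in> Rist G U" and v: "\<And>l::nat. v l \<in> Rist G U" and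
    nc: "\<And>k k' l l'. \<lbrakk>k \<in> {..R}; k' \<in> {..R}; l \<in> ?B; l' \<in> ?B; k \<noteq> k'; l \<noteq> l'\<rbrakk> \<Longrightarrow>
       (inv (s k) \<circ> s k') \<circ> (v l \<circ> inv (v l')) \<noteq> (v l \<circ> inv (v l')) \<circ> (inv (s k) \<circ> s k')"
    by (rule noncommuting_families[OF G ncomm U fin]) (assumption, assumption, rule that)
  have ss: "supp_in (s k) U" and sv: "supp_in (v l) U" for k l
    using Rist_supp_in[OF G] s v by auto
  have bs: "bij (s k)" and bv: "bij (v l)" for k l using supp_in_bij[OF ss] supp_in_bij[OF sv] by auto
  define w where "w = (\<lambda>(k, l). s k \<circ> v l)"
  have wR: "w e \<in> Rist G U" for e
    unfolding w_def using s v Rist_comp[OF G] by (auto split: prod.split)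
  have inj: "inj_on w ?E"
  proof (rule inj_onI)
    fix e e' assume "e \<in> ?E" "e' \<in> ?E" "w e = w e'"
    moreover obtain k l k' l' where e: "e = (k, l)" "e' = (k', l')" by (cases e, cases e')
    ultimately have kl: "k \<in> {..R}" "l \<in> ?B" "k' \<in> {..R}" "l' \<in> ?B" "w (k, l) = w (k', l')"
      by auto
    have eq: "s k (v l x) = s k' (v l' x)" for x using fun_cong[OF kl(5), of x] by (simp add: w_def)
    have "k = k'"
    proof (rule ccontr)
      assume "k \<noteq> k'"
      \<comment> \<open>An element commutes with itself, so this equality contradicts
        \<open>nc\<close> unless the columns agree.\<close>
      have eq': "inv (s k') \<circ> s k = v l' \<circ> inv (v l)"
      proof
        fix x show "(inv (s k') \<circ> s k) x = (v l' \<circ> inv (v l)) x"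
          using eq[of "inv (v l) x"] bs bv by (simp add: bij_cancel)
      qed
      then have "l' = l" using nc[OF kl(3,1,4,2)] \<open>k \<noteq> k'\<close> by auto
      then have "inv (s k') \<circ> s k = id" using eq' bv by (auto simp: fun_eq_iff bij_cancel)
      \<comment> \<open>\<open>k \<noteq> k'\<close> forces \<open>R > 0\<close>, so a second column
        \<open>m\<close> exists; the identity commutes with the quotient for \<open>l\<close> and
        \<open>m\<close>, against \<open>nc\<close>.\<close>
      moreover have "l + 1 \<in> ?B \<or> (l \<noteq> 0 \<and> 0 \<in> ?B) \<or> R = 0" by (cases "l = 0") auto
      moreover have "R \<noteq> 0" using kl \<open>k \<noteq> k'\<close> by auto
      ultimately obtain m where "m \<in> ?B" "m \<noteq> l" by (metis n_not_Suc_n Suc_eq_plus1)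
      then show False using nc[OF kl(3,1,2), of m] \<open>k \<noteq> k'\<close> \<open>inv (s k') \<circ> s k = id\<close> by simp
    qed
    moreover have "l = l'"
    proof (rule ccontr)
      assume "l \<noteq> l'"
      have "v l x = v l' x" for x using eq[of x] \<open>k = k'\<close> bs by (metis bij_cancel(1))
      then have 1: "v l \<circ> inv (v l') = id" using bv by (auto simp: fun_eq_iff bij_cancel)
      \<comment> \<open>With \<open>R = 0\<close> there is a single column. Hence a second row
        \<open>m\<close> exists, and the argument is repeated with rows and columns
        exchanged.\<close>
      have "R \<noteq> 0"
      proof
        assume "R = 0"
        then show False using kl(2,4) \<open>l \<noteq> l'\<close> by simp
      qed
      then obtain m where "m \<in> {..R}" "m \<noteq> k" by (metis atMost_iff le0 order_refl)
      then show False using nc[of m k l l'] kl \<open>l \<noteq> l'\<close> 1 by simp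
    qed
    ultimately show "e = e'" by (simp add: e)
  qed
  have cardT: "card (w ` ?E) = card ?E" by (rule card_image[OF inj])
  show ?thesis
  proof (intro exI[of _ "w ` ?E"] conjI allI impI)
    show "w ` ?E \<subseteq> Rist G U" using wR by auto
    fix Z assume ZT: "Z \<subseteq> w ` ?E"
      and Q: "\<forall>w\<in>Z. \<forall>w'\<in>Z. inv w \<circ> w' \<circ> (p \<circ> (w \<circ> inv w') \<circ> inv p) \<in> H"
    define Y where "Y = {e\<in>?E. w e \<in> Z}"
    have "Z = w ` Y" using ZT by (auto simp: Y_def)
    moreover have "inj_on w Y" using inj by (rule inj_on_subset) (auto simp: Y_def)
    ultimately have "card Z = card Y" by (simp add: card_image)
    also have "card Y * R < card ?E"
    proof (rule rectangle_free_sparse)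
      show "Y \<subseteq> ?E" by (auto simp: Y_def)
      fix k k' l l' assume Y: "(k, l) \<in> Y" "(k', l) \<in> Y" "(k, l') \<in> Y" "(k', l') \<in> Y" "k \<noteq> k'"
      have ws: "supp_in (w e) U" for e using wR Rist_supp_in[OF G] by blast
      \<comment> \<open>This is the conjugate by \<open>inv (v l)\<close> of the commutator of
        \<open>inv (s k) \<circ> s k'\<close> and \<open>v l \<circ> inv (v l')\<close>.\<close>
      let ?h = "inv (w (k, l)) \<circ> w (k', l) \<circ> inv (w (k', l')) \<circ> w (k, l')"
      have iw: "inv (w (k, l)) = inv (v l) \<circ> inv (s k)" for k l
        using bs bv by (simp add: w_def o_inv_distrib)
      have "?h \<in> H"
      proof (rule conj_quotient_rectangle[OF H p ws ws ws ws])
        show "w (k, l) \<circ> inv (w (k', l)) \<circ> w (k', l') \<circ> inv (w (k, l')) = id"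
          unfolding iw using bs bv by (auto simp: w_def fun_eq_iff bij_cancel)
      qed (use Q Y in \<open>auto simp: Y_def\<close>)
      moreover have "?h \<in> Rist G U"
        using wR by (intro Rist_comp Rist_inv G)
      ultimately have hid: "?h = id" using triv by auto
      have h: "inv (v l) (inv (s k) (s k' (v l (inv (v l') (inv (s k') (s k (v l' x))))))) = x" for x
        using fun_cong[OF hid, of x] unfolding iw by (simp add: w_def)
      show "l = l'"
      proof (rule ccontr)
        assume "l \<noteq> l'"
        have "inv (s k) (s k' (v l (inv (v l') x))) = v l (inv (v l') (inv (s k) (s k' x)))" for x
          using arg_cong[OF h[of "inv (v l') (inv (s k) (s k' x))"], of "v l"] bs bv
          by (simp add: bij_cancel)
        then show False using nc[of k k' l l'] Y \<open>l \<noteq> l'\<close> by (auto simp: Y_def fun_eq_iff)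
      qed
    qed
    finally show "card Z * R < card (w ` ?E)" by (simp only: cardT)
  qed auto
next
  assume "\<exists>T\<subseteq>Rist G U. finite T \<and> R < card T \<and>
        (\<forall>s\<in>T. \<forall>t\<in>T. inv s \<circ> t \<in> proj_group H p U \<longrightarrow> s = t)"
  then obtain T where T: "T \<subseteq> Rist G U" "finite T" "R < card T"
    and sep: "\<And>s t. \<lbrakk>s \<in> T; t \<in> T; inv s \<circ> t \<in> proj_group H p U\<rbrakk> \<Longrightarrow> s = t" by blast
  show ?thesis
  proof (intro exI[of _ T] conjI allI impI T)
    show "T \<noteq> {}" using T by auto
    fix Z assume Z: "Z \<subseteq> T"
      and Q: "\<forall>w\<in>Z. \<forall>w'\<in>Z. inv w \<circ> w' \<circ> (p \<circ> (w \<circ> inv w') \<circ> inv p) \<in> H"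
    have "w = w'" if w: "w \<in> Z" "w' \<in> Z" for w w'
    proof (rule sep)
      have "supp_in w U" "supp_in w' U" using w Z T Rist_supp_in[OF G] by auto
      then have "supp_in (inv w \<circ> w') U" "supp_in (p \<circ> (w \<circ> inv w') \<circ> inv p) (p ` U)"
        using p by (auto intro!: supp_in_comp supp_in_inv supp_in_conj)
      then show "inv w \<circ> w' \<in> proj_group H p U"
        using Q w unfolding proj_group_def by blast
    qed (use w Z in auto)
    then have "card Z \<le> 1"
      using card_le_Suc0_iff_eq[OF finite_subset[OF Z T(2)]] by auto
    then have "card Z * R \<le> 1 * R" by (rule mult_le_mono1)
    then show "card Z * R < card T" using T(3) by linarith
  qed
qed

section \<open>From finite index to all commutators of a rigid stabilizer\<close>

text \<open>On \<open>A'\<close> and on \<open>B'\<close> only one of the two products acts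
  non-trivially, so the commutator is concentrated on \<open>A\<close>, where the products act as
  \<open>a\<close> and \<open>b\<close>.\<close>

lemma commutator_disjoint_factors:
  assumes s: "supp_in a A" "supp_in b A" "supp_in a' A'" "supp_in b' B'"
    and disj: "A \<inter> A' = {}" "A \<inter> B' = {}" "A' \<inter> B' = {}"
  shows "(inv a' \<circ> a) \<circ> (inv b' \<circ> b) \<circ> inv (inv a' \<circ> a) \<circ> inv (inv b' \<circ> b)
    = a \<circ> b \<circ> inv a \<circ> inv b"
proof
  fix x
  have bij: "bij a" "bij b" "bij a'" "bij b'" using s supp_in_bij by auto
  have inv: "inv (inv a' \<circ> a) = inv a \<circ> a'" "inv (inv b' \<circ> b) = inv b \<circ> b'"
    using bij by (simp_all add: o_inv_distrib inv_inv_eq bij_imp_bij_inv)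
  have sA: "supp_in (a \<circ> b \<circ> inv a \<circ> inv b) A" "supp_in (inv b) A"
    by (intro supp_in_comp supp_in_inv s)+
  have "supp_in b (A \<union> A')" "supp_in a (A \<union> A')" "supp_in a' (A \<union> A')"
    using s supp_in_mono by blast+
  then have sAA: "supp_in (b \<circ> inv a \<circ> a' \<circ> inv b) (A \<union> A')"
    by (intro supp_in_comp supp_in_inv)
  have AA: "(A \<union> A') \<inter> B' = {}" using disj by blast
  have 1: "b (inv a (a' (inv b (inv b' y)))) = inv b' (b (inv a (a' (inv b y))))" for y
    using supp_in_commute[OF sAA supp_in_inv[OF s(4)] AA, of y] by simp
  have 2: "inv b (a' y) = a' (inv b y)" for y
    by (rule supp_in_commute[OF sA(2) s(3) disj(1)])
  have 3: "a (b (inv a (inv b (inv a' y)))) = inv a' (a (b (inv a (inv b y))))" for y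
    using supp_in_commute[OF sA(1) supp_in_inv[OF s(3)] disj(1), of y] by simp
  have "((inv a' \<circ> a) \<circ> (inv b' \<circ> b) \<circ> inv (inv a' \<circ> a) \<circ> inv (inv b' \<circ> b)) x
    = inv a' (a (inv b' (b (inv a (a' (inv b (b' x)))))))"
    by (simp add: inv)
  also have "\<dots> = inv a' (a (b (inv a (inv b (a' x)))))"
    using bij by (simp add: bij_cancel 2 flip: 1)
  also have "\<dots> = (a \<circ> b \<circ> inv a \<circ> inv b) x"
    using bij by (simp add: bij_cancel flip: 3)
  finally show "((inv a' \<circ> a) \<circ> (inv b' \<circ> b) \<circ> inv (inv a' \<circ> a) \<circ> inv (inv b' \<circ> b)) x
    = (a \<circ> b \<circ> inv a \<circ> inv b) x" .
qed

lemma three_equal_values: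
  assumes "finite J" "finite X" "S ` J \<subseteq> X" "2 * card X < card J"
  obtains i j k where "i \<in> J" "j \<in> J" "k \<in> J" "i \<noteq> j" "i \<noteq> k" "j \<noteq> k" "S i = S j" "S i = S k"
proof -
  have "\<exists>x\<in>X. 2 < card {j\<in>J. S j = x}"
  proof (rule ccontr)
    assume "\<not> ?thesis"
    then have le: "\<And>x. x \<in> X \<Longrightarrow> card {j\<in>J. S j = x} \<le> 2" by (meson not_le)
    have "J = (\<Union>x\<in>X. {j\<in>J. S j = x})" using assms(3) by auto
    then have "card J \<le> (\<Sum>x\<in>X. card {j\<in>J. S j = x})"
      using card_UN_le[OF assms(2), of "\<lambda>x. {j\<in>J. S j = x}"] by simp
    also have "\<dots> \<le> (\<Sum>x\<in>X. 2)" using le by (rule sum_mono)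
    finally show False using assms(4) by simp
  qed
  then obtain x where "2 < card {j\<in>J. S j = x}" by blast
  then have "3 \<le> card {j\<in>J. S j = x}" by simp
  then obtain K where "K \<subseteq> {j\<in>J. S j = x}" "card K = 3" by (metis obtain_subset_with_card_n)
  then obtain i j k where "{i, j, k} \<subseteq> {j\<in>J. S j = x}" "i \<noteq> j" "i \<noteq> k" "j \<noteq> k"
    by (auto simp: card_3_iff)
  then show ?thesis by (intro that[of i j k]) auto
qed

text \<open>The hypothesis \<open>index\<close> bounds by \<open>R\<close> the number of left cosets
  of \<open>proj_group H p U\<close> met by \<open>Rist G U\<close>, phrased through finite sets of
  pairwise inequivalent elements.\<close>

lemma commutators_mem_of_finite_index:
  fixes U :: "'a::t2_space set"
  assumes G: "homeo_subgroup G" and H: "homeo_subgroup H"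
    and inf: "\<And>V::'a set. open V \<Longrightarrow> V \<noteq> {} \<Longrightarrow> infinite V"
    and U: "open U" and disj: "p ` U \<inter> U = {}"
    and n: "n \<in> H" "n \<in> Rist G U" "n \<noteq> id"
    and index: "\<And>T. \<lbrakk>T \<subseteq> Rist G U; finite T;
      \<And>s t. \<lbrakk>s \<in> T; t \<in> T; inv s \<circ> t \<in> proj_group H p U\<rbrakk> \<Longrightarrow> s = t\<rbrakk> \<Longrightarrow> card T \<le> R"
  shows "\<exists>V. open V \<and> V \<noteq> {} \<and> (\<forall>a\<in>Rist G V. \<forall>b\<in>Rist G V. a \<circ> b \<circ> inv a \<circ> inv b \<in> H)"
proof -
  let ?K = "proj_group H p U"
  have sn: "supp_in n U" using n G Rist_supp_in by blast
  obtain y where y: "n y \<noteq> y" using n(3) by (auto simp: fun_eq_iff)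
  then have yU: "y \<in> U" using supp_in_fix[OF sn] by blast
  obtain A B where AB: "open A" "open B" "n y \<in> A" "y \<in> B" "A \<inter> B = {}"
    using hausdorff[OF y] by blast
  have "continuous_on UNIV n" using n(1) H by (auto simp: homeo_subgroup_def Homeo_def homeo_def)
  then have "open (n -` A)" using AB by (simp add: open_vimage)
  define V where "V = U \<inter> B \<inter> n -` A"
  have V: "open V" "y \<in> V" "V \<subseteq> U" "n ` V \<inter> V = {}"
    using AB U yU \<open>open (n -` A)\<close> by (auto simp: V_def)
  have infV: "infinite V" using inf V by blast
  define Pr where "Pr T \<longleftrightarrow> T \<subseteq> Rist G U \<and> finite T \<and> (\<forall>s\<in>T. \<forall>t\<in>T. inv s \<circ> t \<in> ?K \<longrightarrow> s = t)" for T
  have Pr0: "Pr {}" by (simp add: Pr_def)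
  have "card T \<le> R" if "Pr T" for T
    using that by (intro index) (simp_all add: Pr_def)
  then have "\<forall>T. Pr T \<longrightarrow> card T < Suc R" by (simp add: less_Suc_eq_le)
  \<comment> \<open>A largest set of pairwise inequivalent elements represents every coset, since
    otherwise it could be enlarged.\<close>
  then obtain T where T: "Pr T" "\<And>T'. Pr T' \<Longrightarrow> card T' \<le> card T"
    using ex_has_greatest_nat[where P = Pr and f = card, OF Pr0] by blast
  have inv_comp: "inv x \<circ> z \<in> ?K \<longleftrightarrow> inv z \<circ> x \<in> ?K" if "bij x" "bij z" for x z
  proof -
    have "inv (inv x \<circ> z) = inv z \<circ> x" "inv (inv z \<circ> x) = inv x \<circ> z"
      using that by (simp_all add: o_inv_distrib bij_imp_bij_inv inv_inv_eq)
    then show ?thesis using proj_group_inv[where H = H and p = p and U = U, OF H disj] by metis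
  qed
  have cosets: "\<exists>t\<in>T. inv t \<circ> g \<in> ?K" if g: "g \<in> Rist G U" for g
  proof (rule ccontr)
    assume no: "\<not> ?thesis"
    have bg: "bij g" using g Rist_supp_in[OF G] supp_in_bij by blast
    have "inv g \<circ> g = id" using bg by (simp add: bij_is_inj)
    then have "g \<notin> T" using no proj_group_id[OF H] by metis
    have "Pr (insert g T)"
      unfolding Pr_def
    proof (intro conjI ballI impI)
      show "insert g T \<subseteq> Rist G U" "finite (insert g T)" using T(1) g by (auto simp: Pr_def)
      fix s t assume st: "s \<in> insert g T" "t \<in> insert g T" "inv s \<circ> t \<in> ?K"
      then have "s \<in> Rist G U" "t \<in> Rist G U" using T(1) g by (auto simp: Pr_def)
      then have "bij s" "bij t" using Rist_supp_in[OF G] supp_in_bij by blast+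
      then have "inv t \<circ> s \<in> ?K" using st(3) inv_comp by blast
      then show "s = t" using st no T(1) by (auto simp: Pr_def)
    qed
    then have "card (insert g T) \<le> card T" by (rule T(2))
    then show False using \<open>g \<notin> T\<close> T(1) by (simp add: Pr_def)
  qed
  have TR: "T \<subseteq> Rist G U" "finite T" using T(1) by (auto simp: Pr_def)
  \<comment> \<open>This has \<open>2 * card (Pow T) + 1\<close> indices, so three of them share the
    same set \<open>S j\<close> of cosets met by \<open>Rist G (W j)\<close>.\<close>
  define J where "J = {..2 * card (Pow T)}"
  have "finite J" by (simp add: J_def)
  obtain W where W: "\<And>j. j \<in> J \<Longrightarrow> open (W j)" "\<And>j. j \<in> J \<Longrightarrow> W j \<noteq> {}"
    "\<And>j. j \<in> J \<Longrightarrow> W j \<subseteq> V" "disjoint_family_on W J"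
    by (rule disjoint_open_subsets[OF V(1) infV \<open>finite J\<close>]) (rule that)
  define S where "S j = {t\<in>T. \<exists>g\<in>Rist G (W j). inv t \<circ> g \<in> ?K}" for j
  obtain i j k where ijk: "i \<in> J" "j \<in> J" "k \<in> J" "i \<noteq> j" "i \<noteq> k" "j \<noteq> k" "S i = S j" "S i = S k"
  proof (rule three_equal_values[of J "Pow T" S])
    show "S ` J \<subseteq> Pow T" by (auto simp: S_def)
  qed (use TR in \<open>auto simp: J_def\<close>)
  have WU: "Rist G (W l) \<subseteq> Rist G U" if "l \<in> J" for l
    using W(3)[OF that] V(3) by (intro Rist_mono) blast
  have transfer: "\<exists>a'\<in>Rist G (W l). inv a' \<circ> a \<in> ?K" if a: "a \<in> Rist G (W i)" and l: "l \<in> J" "S i = S l" for a l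
  proof -
    obtain t where t: "t \<in> T" "inv t \<circ> a \<in> ?K" using cosets WU[OF ijk(1)] a by blast
    then have "t \<in> S l" using a l(2) by (auto simp: S_def)
    then obtain a' where a': "a' \<in> Rist G (W l)" "inv t \<circ> a' \<in> ?K" by (auto simp: S_def)
    have b: "bij t" "bij a'"
      using t(1) TR a'(1) WU[OF l(1)] Rist_supp_in[OF G] supp_in_bij by blast+
    have "inv (inv t \<circ> a') \<circ> (inv t \<circ> a) = inv a' \<circ> a"
      using b by (auto simp: o_inv_distrib bij_imp_bij_inv inv_inv_eq fun_eq_iff bij_cancel)
    then show ?thesis using proj_group_inv_comp[OF H disj t(2) a'(2)] a'(1) by auto
  qed
  have disjW: "W i \<inter> W j = {}" "W i \<inter> W k = {}" "W j \<inter> W k = {}"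
    using W(4) ijk by (auto simp: disjoint_family_on_def)
  show ?thesis
  proof (intro exI[of _ "W i"] conjI ballI)
    show "open (W i)" "W i \<noteq> {}" using W ijk by auto
    fix a b assume ab: "a \<in> Rist G (W i)" "b \<in> Rist G (W i)"
    obtain a' where a': "a' \<in> Rist G (W j)" "inv a' \<circ> a \<in> ?K"
      using transfer[OF ab(1) ijk(2,7)] by blast
    obtain b' where b': "b' \<in> Rist G (W k)" "inv b' \<circ> b \<in> ?K"
      using transfer[OF ab(2) ijk(3,8)] by blast
    have s: "supp_in a (W i)" "supp_in b (W i)" "supp_in a' (W j)" "supp_in b' (W k)"
      using ab a' b' Rist_supp_in[OF G] by auto
    have bij: "bij a" "bij b" "bij a'" "bij b'" using s supp_in_bij by auto
    have sV: "supp_in a V" "supp_in b V" "supp_in a' V" "supp_in b' V"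
      using s W(3) ijk supp_in_mono by metis+
    \<comment> \<open>The inverse is taken because \<open>double_commutator_mem\<close> yields the
      commutator of \<open>inv c\<close> and \<open>d\<close>.\<close>
    define c where "c = inv (inv a' \<circ> a)"
    define d where "d = inv b' \<circ> b"
    have cK: "c \<in> ?K" unfolding c_def by (rule proj_group_inv[OF H disj a'(2)])
    have dK: "d \<in> ?K" unfolding d_def by (rule b'(2))
    have cV: "supp_in c V" "supp_in d V"
      unfolding c_def d_def using sV by (auto intro!: supp_in_comp supp_in_inv)
    have mem: "inv c \<circ> d \<circ> c \<circ> inv d \<in> H"
      by (rule double_commutator_mem[OF H disj n(1) sn V(3,4) cK cV(1) dK cV(2)])
    have ic: "inv c = inv a' \<circ> a"
      unfolding c_def using bij by (simp add: inv_inv_eq bij_comp bij_imp_bij_inv)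
    have "inv c \<circ> d \<circ> c \<circ> inv d = a \<circ> b \<circ> inv a \<circ> inv b"
      using commutator_disjoint_factors[OF s disjW] ic by (simp add: c_def d_def)
    then show "a \<circ> b \<circ> inv a \<circ> inv b \<in> H" using mem by simp
  qed
qed

section \<open>Contradiction between confinement and sparse fibres\<close>

theorem theorem4p5:
  fixes G :: "('a::t2_space \<Rightarrow> 'a) set"
    and H :: "nat \<Rightarrow> ('a \<Rightarrow> 'a) set"
    and n :: nat
  assumes "homeo_subgroup G"
    and "n \<ge> 1"
    and "\<forall>i\<in>{1..n}. homeo_subgroup (H i)"
    and "confined G n H"
  shows "\<exists>k\<in>{1..n}. \<exists>U. open U \<and> U \<noteq> {} \<and> derived (Rist G U) \<subseteq> H k"
proof (rule ccontr)
  assume contra: "\<not> ?thesis"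
  note G = assms(1)
  have H: "homeo_subgroup (H k)" if "k \<in> {1..n}" for k using assms(3) that by blast
  have neg: "\<exists>a\<in>Rist G V. \<exists>b\<in>Rist G V. a \<circ> b \<circ> inv a \<circ> inv b \<notin> H k"
    if "k \<in> {1..n}" "open V" "V \<noteq> {}" for k V
    using contra derived_subset[OF H[OF that(1)], of "Rist G V"] that by blast
  \<comment> \<open>Commuting elements have commutator \<open>id\<close>, which lies in
    \<open>H 1\<close>, so \<open>neg\<close> for the index 1 suffices.\<close>
  have ncomm: "\<exists>a\<in>Rist G V. \<exists>b\<in>Rist G V. a \<circ> b \<noteq> b \<circ> a" if V: "open V" "V \<noteq> {}" for V
  proof -
    have 1: "1 \<in> {1..n}" using assms(2) by simp
    obtain a b where ab: "a \<in> Rist G V" "b \<in> Rist G V" "a \<circ> b \<circ> inv a \<circ> inv b \<notin> H 1"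
      using neg[OF 1 V] by blast
    have "bij a" "bij b" using ab Rist_supp_in[OF G] supp_in_bij by blast+
    then have "a \<circ> b \<circ> inv a \<circ> inv b = id" if "a \<circ> b = b \<circ> a"
      using that by (simp add: fun_eq_iff bij_cancel)
    then show ?thesis using ab homeo_subgroup_id[OF H[OF 1]] by metis
  qed
  have inf: "infinite V" if "open V" "V \<noteq> {}" for V :: "'a set"
    by (rule open_infinite[OF G ncomm that])
  obtain P where P: "finite P" "P \<subseteq> Homeo - {id}"
    and conf: "\<forall>g\<in>G. \<exists>j\<in>{1..n}. (\<lambda>h. g \<circ> h \<circ> inv g) ` H j \<inter> P \<noteq> {}"
    using assms(4) unfolding confined_def by (elim exE conjE) (rule that)
  have cover: "\<exists>i\<in>P \<times> {1..n}. inv g \<circ> fst i \<circ> g \<in> H (snd i)" if g: "g \<in> G" for g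
  proof -
    obtain j h where jh: "j \<in> {1..n}" "h \<in> H j" "g \<circ> h \<circ> inv g \<in> P" using bspec[OF conf g] by blast
    have "inv g \<circ> (g \<circ> h \<circ> inv g) \<circ> g = h"
      using homeo_subgroup_bij[OF G g] by (simp add: fun_eq_iff bij_cancel)
    then show ?thesis using jh by (intro bexI[of _ "(g \<circ> h \<circ> inv g, j)"]) auto
  qed
  define I where "I = P \<times> {1..n}"
  have finI: "finite I" using P by (simp add: I_def)
  have "I \<noteq> {}" using cover[OF homeo_subgroup_id[OF G]] by (auto simp: I_def)
  have hom: "homeo (fst i)" "fst i \<noteq> id" if "i \<in> I" for i
    using that P by (auto simp: I_def Homeo_def)
  have HI: "homeo_subgroup (H (snd i))" if "i \<in> I" for i using that H by (auto simp: I_def)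
  obtain U where U: "\<And>i. i \<in> I \<Longrightarrow> open (U i)" "\<And>i. i \<in> I \<Longrightarrow> U i \<noteq> {}"
    "disjoint_family_on U I" "\<And>i j. i \<in> I \<Longrightarrow> j \<in> I \<Longrightarrow> fst i ` U i \<inter> U j = {}"
    by (rule displaced_open_sets[OF inf finI hom]) (assumption | rule that)+
  define sparse where "sparse i T \<longleftrightarrow> T \<subseteq> Rist G (U i) \<and> finite T \<and> T \<noteq> {} \<and>
    (\<forall>Z\<subseteq>T. (\<forall>w\<in>Z. \<forall>w'\<in>Z. inv w \<circ> w' \<circ> (fst i \<circ> (w \<circ> inv w') \<circ> inv (fst i)) \<in> H (snd i))
       \<longrightarrow> card Z * card I < card T)" for i T
  have bijI: "bij (fst i)" if "i \<in> I" for i using hom[OF that] by (simp add: homeo_def)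
  have "\<forall>i\<in>I. \<exists>T. sparse i T"
  proof
    fix i assume i: "i \<in> I"
    have disj: "fst i ` U i \<inter> U i = {}" by (rule U(4)[OF i i])
    let ?small = "H (snd i) \<inter> Rist G (U i) \<subseteq> {id} \<or>
      (\<exists>T\<subseteq>Rist G (U i). finite T \<and> card I < card T \<and>
        (\<forall>s\<in>T. \<forall>t\<in>T. inv s \<circ> t \<in> proj_group (H (snd i)) (fst i) (U i) \<longrightarrow> s = t))"
    \<comment> \<open>Otherwise \<open>m\<close> and the index bound would put all commutators of
      some \<open>Rist G V\<close> into \<open>H (snd i)\<close>, against
      \<open>neg\<close>.\<close>
    have small: ?small
    proof (rule ccontr)
      assume *: "\<not> ?small"
      then obtain m where m: "m \<in> H (snd i)" "m \<in> Rist G (U i)" "m \<noteq> id" by blast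
      have index: "card T \<le> card I" if "T \<subseteq> Rist G (U i)" "finite T"
        "\<And>s t. \<lbrakk>s \<in> T; t \<in> T; inv s \<circ> t \<in> proj_group (H (snd i)) (fst i) (U i)\<rbrakk> \<Longrightarrow> s = t" for T
        using * that by (meson not_le)
      have "\<exists>V. open V \<and> V \<noteq> {} \<and> (\<forall>a\<in>Rist G V. \<forall>b\<in>Rist G V. a \<circ> b \<circ> inv a \<circ> inv b \<in> H (snd i))"
        by (rule commutators_mem_of_finite_index[OF G HI[OF i] inf U(1)[OF i] disj m index])
      moreover have "snd i \<in> {1..n}" using i by (auto simp: I_def)
      ultimately show False using neg by blast
    qed
    show "\<exists>T. sparse i T"
      unfolding sparse_def
      by (rule sparse_test_set[OF G HI[OF i] ncomm U(1)[OF i] inf[OF U(1)[OF i] U(2)[OF i]]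
            bijI[OF i] disj small]) assumption+
  qed
  from bchoice[OF this] obtain T where T: "\<And>i. i \<in> I \<Longrightarrow> sparse i (T i)" by blast
  have T_Rist: "T i \<subseteq> Rist G (U i)" and T_fin: "finite (T i)" "T i \<noteq> {}" if "i \<in> I" for i
    using T[OF that] unfolding sparse_def by simp_all
  have T_sparse: "card Z * card I < card (T i)" if "i \<in> I" "Z \<subseteq> T i"
    "\<And>w w'. w \<in> Z \<Longrightarrow> w' \<in> Z \<Longrightarrow>
      inv w \<circ> w' \<circ> (fst i \<circ> (w \<circ> inv w') \<circ> inv (fst i)) \<in> H (snd i)" for i Z
    using T[OF that(1)] that(2,3) unfolding sparse_def by simp
  \<comment> \<open>Confinement makes these sets cover \<open>PiE I T\<close>, while
    \<open>conj_quotient_mem\<close> makes each fibre of \<open>?A i\<close> in direction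
    \<open>i\<close> a set to which \<open>T_sparse\<close> applies.\<close>
  let ?A = "\<lambda>i. {f. inv (glue I U f) \<circ> fst i \<circ> glue I U f \<in> H (snd i)}"
  have glueG: "glue I U f \<in> G" if "f \<in> PiE I T" for f
  proof -
    have "f i \<in> Rist G (U i)" if "i \<in> I" for i using \<open>f \<in> PiE I T\<close> T_Rist[OF that] that by (auto simp: PiE_iff)
    then show ?thesis using glue_Rist[OF G finI U(3)] by (auto simp: Rist_def)
  qed
  have "\<not> PiE I T \<subseteq> (\<Union>i\<in>I. ?A i)"
  proof (rule not_covered_by_sparse_fibres[OF finI \<open>I \<noteq> {}\<close>])
    show "finite (T i)" "T i \<noteq> {}" if "i \<in> I" for i using T_fin[OF that] by auto
    fix i f assume i: "i \<in> I" and f: "f \<in> PiE I T"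
    let ?Z = "{t\<in>T i. f(i := t) \<in> ?A i}"
    let ?B = "\<Union>j\<in>I - {i}. U j"
    let ?b = "glue (I - {i}) U f"
    have d': "disjoint_family_on U (I - {i})" using U(3) by (auto simp: disjoint_family_on_def)
    have "f j \<in> Rist G (U j)" if "j \<in> I - {i}" for j
      using f T_Rist[of j] that by (auto simp: PiE_iff)
    then have "?b \<in> Rist G ?B" using glue_Rist[OF G _ d'] finI by blast
    then have b: "supp_in ?b ?B" by (rule Rist_supp_in[OF G])
    have UB: "U i \<inter> ?B = {}" using U(3) i by (fastforce simp: disjoint_family_on_def)
    have pUB: "fst i ` U i \<inter> (U i \<union> ?B) = {}" using U(4)[OF i] i by blast
    have "inv w \<circ> w' \<circ> (fst i \<circ> (w \<circ> inv w') \<circ> inv (fst i)) \<in> H (snd i)"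
      if w: "w \<in> ?Z" "w' \<in> ?Z" for w w'
    proof -
      have s: "supp_in w (U i)" "supp_in w' (U i)"
        using w T_Rist[OF i] Rist_supp_in[OF G] by auto
      show ?thesis
        by (rule conj_quotient_mem[OF HI[OF i] bijI[OF i] s b UB pUB])
          (use w glue_upd[OF U(3) i s(1)] glue_upd[OF U(3) i s(2)] in simp_all)
    qed
    then show "card ?Z * card I < card (T i)" by (intro T_sparse i) auto
  qed
  moreover have "PiE I T \<subseteq> (\<Union>i\<in>I. ?A i)" using cover glueG by (auto simp: I_def)
  ultimately show False by blast
qed

end
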